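(* Let $I$ be an instance of Flow Shop Scheduling with Stochastic Reentry with $m$ machines and $n$ jobs, and let $\pi$ be a (feasible, non-anticipatory) policy for $I$. Then for every $k\in\{1,\dots,m\}$ the policy $\pi_k$ induced by $\pi$ on the auxiliary instance $I_k$ is feasible for $I_k$, and for every job $j\in\{1,\dots,n\}$ and every realization $y=(y_1,\dots,y_n)$ of the numbers of loops $(Y_1,\dots,Y_n)$, $$C_j^{\pi}(y)=\sum_{k=1}^m C_j^{\pi_k}(y),$$ where $C_j^{\pi}(y)$ is the completion time of job $j$ in $I$ under $\pi$ and $C_j^{\pi_k}(y)$ its completion time in $I_k$ under $\pi_k$ (with processing times $X_j=y_j$).
   Context: Flow Shop Scheduling with Stochastic Reentry: there are machines $1,\dots,m$ and jobs $1,\dots,n$; job $j$ requires $Y_j$ passes ("loops") through the machines $1,2,\dots,m$ in this order, where $Y_1,\dots,Y_n$ are independent positive-integer-valued random variables whose distributions are known but whose realizations are not. Every operation takes unit time. A loop of a job started on machine $1$ at integer time $\tau$ is processed on machine $i$ during $[\tau+i-1,\tau+i)$ and completes at time $\tau+m$; hence at most one loop may start at each integer time, and the loops of a job are processed one after another (the next loop of a job can start at time $\tau+m$ or later). The completion time $C_j$ of job $j$ is the completion time of its $Y_j$-th loop. A policy decides at each integer time $\tau$ either to start a loop of some uncompleted job not currently in a loop, or to start nothing; it is non-anticipatory, i.e. its decisions may depend on the instance, the current time and the past (including which jobs have completed and when), but not on the realizations of the $Y_j$ of uncompleted jobs. Stochastic Scheduling with Machine Arrivals: $m$ identical parallel machines,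 machine $i$ may only be used from its arrival time $a_i$ on; jobs $j$ have random processing times $X_j$; each machine processes at most one job at a time, each job is processed by at most one machine at a time, and $C_j$ is the time at which job $j$ has received $X_j$ units of processing. Auxiliary instances: for $k\in\{1,\dots,m\}$, $I_k$ is the instance of Stochastic Scheduling with Machine Arrivals with $m$ machines, one job $j$ with processing time $X_j=Y_j$ (and the same weight) for every job $j$ of $I$, and arrival times $a_i^k=0$ if $i+k\le m+1$ and $a_i^k=1$ otherwise. Induced policy: given a policy $\pi$ for $I$, whenever $\pi$ starts a loop of job $j$ (or idles) at time $\tau=m t+i-1$ with $t=\lfloor\tau/m\rfloor$, $i=(\tau\bmod m)+1$, the induced policy $\pi_k$ processes job $j$ (or idles) on machine $i$ during the time interval $[t+a_i^k,\,t+a_i^k+1)$. *)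

theory Defs
  imports "HOL-Probability.Probability"
begin

text \<open>
  Machines are the numbers 1, ..., m and jobs the numbers 1, ..., n. A policy is represented by the
  schedule it produces for every realization of the random job lengths; that its decisions use
  observable information only is the non-anticipativity clause of the feasibility predicates.
  Completion times live in \<open>ereal\<close>: a policy need not finish all jobs, and the completion time of a
  job that is never finished is \<open>\<infinity>\<close> (the infimum of the empty set).
\<close>

section \<open>Flow shop scheduling with stochastic reentry\<close>

record flow_shop =
  fs_machines :: nat
  fs_jobs :: nat
  fs_weight :: "nat \<Rightarrow> real"
  fs_loops :: "nat \<Rightarrow> nat pmf"

definition flow_shop_instance :: "flow_shop \<Rightarrow> bool" where
  "flow_shop_instance I \<longleftrightarrow>
     1 \<le> fs_machines I \<and> (\<forall>j\<in>{1..fs_jobs I}. 0 \<notin> set_pmf (fs_loops I j))"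

text \<open>The numbers of loops are independent, so their joint law is a product; components that are
  not jobs are fixed to 0.\<close>

definition fs_realizations :: "flow_shop \<Rightarrow> (nat \<Rightarrow> nat) set" where
  "fs_realizations I = set_pmf (Pi_pmf {1..fs_jobs I} 0 (fs_loops I))"

text \<open>\<open>\<pi> y \<tau>\<close> is the job of which a loop is started on machine 1 at time \<open>\<tau>\<close> under realization \<open>y\<close>,
  or \<open>None\<close> if nothing is started.\<close>

type_synonym fs_policy = "(nat \<Rightarrow> nat) \<Rightarrow> nat \<Rightarrow> nat option"

definition fs_completed_loops :: "flow_shop \<Rightarrow> fs_policy \<Rightarrow> (nat \<Rightarrow> nat) \<Rightarrow> nat \<Rightarrow> nat \<Rightarrow> nat" where
  "fs_completed_loops I \<pi> y j \<tau> = card {\<tau>'. \<pi> y \<tau>' = Some j \<and> \<tau>' + fs_machines I \<le> \<tau>}"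

definition fs_completion :: "flow_shop \<Rightarrow> fs_policy \<Rightarrow> (nat \<Rightarrow> nat) \<Rightarrow> nat \<Rightarrow> ereal" where
  "fs_completion I \<pi> y j = Inf {ereal (real \<tau>) | \<tau>. y j \<le> fs_completed_loops I \<pi> y j \<tau>}"

text \<open>Two realizations look the same at time \<open>\<tau>\<close> if the decisions before \<open>\<tau>\<close> agree and the same jobs
  have completed by \<open>\<tau>\<close>, at the same times.\<close>

definition fs_same_past :: "flow_shop \<Rightarrow> fs_policy \<Rightarrow> nat \<Rightarrow> (nat \<Rightarrow> nat) \<Rightarrow> (nat \<Rightarrow> nat) \<Rightarrow> bool" where
  "fs_same_past I \<pi> \<tau> y y' \<longleftrightarrow>
     (\<forall>\<tau>'<\<tau>. \<pi> y \<tau>' = \<pi> y' \<tau>') \<and>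
     (\<forall>j\<in>{1..fs_jobs I}.
        fs_completion I \<pi> y j \<le> ereal (real \<tau>) \<or> fs_completion I \<pi> y' j \<le> ereal (real \<tau>) \<longrightarrow>
        fs_completion I \<pi> y j = fs_completion I \<pi> y' j)"

definition fs_feasible :: "flow_shop \<Rightarrow> fs_policy \<Rightarrow> bool" where
  "fs_feasible I \<pi> \<longleftrightarrow>
     (\<forall>y\<in>fs_realizations I. \<forall>\<tau> j. \<pi> y \<tau> = Some j \<longrightarrow>
        j \<in> {1..fs_jobs I} \<and>
        ereal (real \<tau>) < fs_completion I \<pi> y j \<and>
        (\<forall>\<tau>'<\<tau>. \<pi> y \<tau>' = Some j \<longrightarrow> \<tau>' + fs_machines I \<le> \<tau>)) \<and>
     (\<forall>y\<in>fs_realizations I. \<forall>y'\<in>fs_realizations I. \<forall>\<tau>.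
        fs_same_past I \<pi> \<tau> y y' \<longrightarrow> \<pi> y \<tau> = \<pi> y' \<tau>)"

section \<open>Stochastic scheduling with machine arrivals\<close>

record machine_arrivals =
  ma_machines :: nat
  ma_jobs :: nat
  ma_weight :: "nat \<Rightarrow> real"
  ma_proc :: "nat \<Rightarrow> real pmf"
  ma_arrival :: "nat \<Rightarrow> real"

definition machine_arrivals_instance :: "machine_arrivals \<Rightarrow> bool" where
  "machine_arrivals_instance J \<longleftrightarrow>
     1 \<le> ma_machines J \<and>
     (\<forall>j\<in>{1..ma_jobs J}. \<forall>x\<in>set_pmf (ma_proc J j). 0 < x) \<and>
     (\<forall>i\<in>{1..ma_machines J}. 0 \<le> ma_arrival J i)"

definition ma_realizations :: "machine_arrivals \<Rightarrow> (nat \<Rightarrow> real) set" where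
  "ma_realizations J = set_pmf (Pi_pmf {1..ma_jobs J} 0 (ma_proc J))"

text \<open>\<open>\<sigma> x i s\<close> is the job processed on machine \<open>i\<close> at the real time \<open>s\<close> under realization \<open>x\<close>, if any;
  in particular a machine processes at most one job at a time. Preemption is allowed.\<close>

type_synonym ma_policy = "(nat \<Rightarrow> real) \<Rightarrow> nat \<Rightarrow> real \<Rightarrow> nat option"

definition ma_received :: "machine_arrivals \<Rightarrow> ma_policy \<Rightarrow> (nat \<Rightarrow> real) \<Rightarrow> nat \<Rightarrow> real \<Rightarrow> real" where
  "ma_received J \<sigma> x j s =
     (\<Sum>i\<in>{1..ma_machines J}. measure lborel {u\<in>{0..<s}. \<sigma> x i u = Some j})"

definition ma_completion :: "machine_arrivals \<Rightarrow> ma_policy \<Rightarrow> (nat \<Rightarrow> real) \<Rightarrow> nat \<Rightarrow> ereal" where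
  "ma_completion J \<sigma> x j = Inf {ereal s | s. 0 \<le> s \<and> x j \<le> ma_received J \<sigma> x j s}"

text \<open>In contrast to discrete time, agreement of the decisions before \<open>s\<close> must not be part of the
  premise here: two schedules that split immediately after a time \<open>s\<close> have no first instant at which
  they differ, so a policy could react to unobserved information. As the clause below applies to
  all times before \<open>s\<close> as well, equal completions up to \<open>s\<close> force equal past decisions.\<close>

definition ma_same_past :: "machine_arrivals \<Rightarrow> ma_policy \<Rightarrow> real \<Rightarrow> (nat \<Rightarrow> real) \<Rightarrow> (nat \<Rightarrow> real) \<Rightarrow> bool" where
  "ma_same_past J \<sigma> s x x' \<longleftrightarrow>
     (\<forall>j\<in>{1..ma_jobs J}.
        ma_completion J \<sigma> x j \<le> ereal s \<or> ma_completion J \<sigma> x' j \<le> ereal s \<longrightarrow>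
        ma_completion J \<sigma> x j = ma_completion J \<sigma> x' j)"

definition ma_feasible :: "machine_arrivals \<Rightarrow> ma_policy \<Rightarrow> bool" where
  "ma_feasible J \<sigma> \<longleftrightarrow>
     (\<forall>x\<in>ma_realizations J. \<forall>i j. {s. \<sigma> x i s = Some j} \<in> sets borel) \<and>
     (\<forall>x\<in>ma_realizations J. \<forall>i s j. \<sigma> x i s = Some j \<longrightarrow>
        i \<in> {1..ma_machines J} \<and>
        j \<in> {1..ma_jobs J} \<and>
        ma_arrival J i \<le> s \<and>
        ereal s < ma_completion J \<sigma> x j \<and>
        (\<forall>i'. \<sigma> x i' s = Some j \<longrightarrow> i' = i)) \<and>
     (\<forall>x\<in>ma_realizations J. \<forall>x'\<in>ma_realizations J. \<forall>s.
        ma_same_past J \<sigma> s x x' \<longrightarrow> (\<forall>i. \<sigma> x i s = \<sigma> x' i s))"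

section \<open>Auxiliary instances and induced policies\<close>

definition aux_instance :: "flow_shop \<Rightarrow> nat \<Rightarrow> machine_arrivals" where
  "aux_instance I k =
     \<lparr> ma_machines = fs_machines I,
       ma_jobs = fs_jobs I,
       ma_weight = fs_weight I,
       ma_proc = (\<lambda>j. map_pmf real (fs_loops I j)),
       ma_arrival = (\<lambda>i. if i + k \<le> fs_machines I + 1 then 0 else 1) \<rparr>"

lemma machine_arrivals_instance_aux:
  assumes "flow_shop_instance I"
  shows "machine_arrivals_instance (aux_instance I k)"
  using assms
  by (auto simp: flow_shop_instance_def machine_arrivals_instance_def aux_instance_def
      intro!: gr0I)

text \<open>With \<open>a\<close> the arrival time of machine \<open>i\<close>, a time \<open>s \<ge> a\<close> lies in the interval from \<open>t + a\<close>
  (inclusive) to \<open>t + a + 1\<close> (exclusive) exactly for \<open>t = \<lfloor>s - a\<rfloor>\<close>. Realizations of the auxiliary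
  instance are integral, and taking the floor recovers the corresponding numbers of loops.\<close>

definition induced_policy :: "flow_shop \<Rightarrow> nat \<Rightarrow> fs_policy \<Rightarrow> ma_policy" where
  "induced_policy I k \<pi> x i s =
     (let a = ma_arrival (aux_instance I k) i in
      if i \<in> {1..fs_machines I} \<and> a \<le> s
      then \<pi> (\<lambda>j. nat \<lfloor>x j\<rfloor>) (fs_machines I * nat \<lfloor>s - a\<rfloor> + i - 1)
      else None)"

end

theory Submission
  imports Defs
begin

text \<open>
  A loop started at time \<open>\<tau>\<close> becomes, in the auxiliary instance \<open>I\<^sub>k\<close>, one unit of processing during
  the integer slot \<open>(\<tau> + k - 1) div m\<close>. Loops of one job start at least \<open>m\<close> time units apart, so they
  occupy different slots, in the same order. If \<open>l\<close> is the start of the last loop of a completed job,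
  the job completes at \<open>l + m\<close> in \<open>I\<close> and at \<open>(l + k - 1) div m + 1\<close> in \<open>I\<^sub>k\<close>; Hermite's identity
  \<open>(\<Sum>k = 1..m. (l + k - 1) div m) = l\<close> gives the claim.

  For non-anticipativity, the completion slot in \<open>I\<^sub>k\<close> does not determine the completion time in
  \<open>I\<close>, but together with the decisions of \<open>\<pi>\<close> before \<open>\<tau>\<close> it does: a job has at most one start in
  each slot. Hence two realizations with the same past in \<open>I\<^sub>k\<close> have, by induction on \<open>\<tau>\<close>, the same
  past at \<open>\<tau>\<close> in \<open>I\<close>.
\<close>

lemma option_eqI:
  assumes "\<And>x. a = Some x \<longleftrightarrow> b = Some x"
  shows "a = b"
  using assms[of "the a"] assms[of "the b"] by (cases a; cases b) simp_all

section \<open>Slots\<close>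

definition slot :: "nat \<Rightarrow> nat \<Rightarrow> nat \<Rightarrow> nat" where
  "slot m k \<tau> = (\<tau> + k - 1) div m"

lemma slot_mono: "\<tau> \<le> \<tau>' \<Longrightarrow> slot m k \<tau> \<le> slot m k \<tau>'"
  unfolding slot_def by (intro div_le_mono) simp

text \<open>Adding \<open>m\<close> to the start raises the quotient by exactly 1. The bound
  \<open>1 \<le> k\<close> makes the truncated subtraction commute with this shift.\<close>

lemma slot_less:
  assumes "0 < m" "1 \<le> k" "\<tau> + m \<le> \<tau>'"
  shows "slot m k \<tau> < slot m k \<tau>'"
proof -
  have "slot m k (\<tau> + m) = Suc (slot m k \<tau>)"
  proof -
    have "\<tau> + m + k - 1 = (\<tau> + k - 1) + m"
      using assms by simp
    then show ?thesis
      using assms(1) by (simp add: slot_def del: add_diff_assoc2)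
  qed
  then show ?thesis
    using slot_mono[OF assms(3), of m k] by simp
qed

text \<open>Ties \<open>slot\<close> to the arrival times: the summand after \<open>t\<close> is the
  arrival time of machine \<open>i\<close> in the \<open>k\<close>-th auxiliary instance. Since
  \<open>i + k - 2 < 2 * m\<close>, its quotient by \<open>m\<close> is 0 or 1, with the jump at
  \<open>i + k = m + 2\<close>.\<close>

lemma slot_eq:
  assumes "1 \<le> i" "i \<le> m" "1 \<le> k" "k \<le> m"
  shows "slot m k (m * t + i - 1) = t + (if i + k \<le> m + 1 then 0 else 1)"
proof -
  have "m * t + i - 1 + k - 1 = (i + k - 2) + t * m"
    using assms by (simp add: mult.commute)
  moreover have "((i + k - 2) + t * m) div m = t + (i + k - 2) div m"
    using assms by (intro div_mult_self1) simp
  ultimately have "slot m k (m * t + i - 1) = t + (i + k - 2) div m"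
    by (simp only: slot_def)
  moreover have "(i + k - 2) div m = (if i + k \<le> m + 1 then 0 else 1)"
  proof (cases "i + k \<le> m + 1")
    case True
    then show ?thesis using assms by simp
  next
    case False
    have "(i + k - 2) div m = 1"
      by (rule div_nat_eqI) (use False assms in auto)
    then show ?thesis using False by simp
  qed
  ultimately show ?thesis by simp
qed

lemma sum_slot:
  assumes "0 < m"
  shows "(\<Sum>k = 1..m. slot m k \<tau>) = \<tau>"
proof -
  have "(\<Sum>k<m. (\<tau> + k) div m) = \<tau>"
  proof (induction \<tau>)
    case 0
    then show ?case by simp
  next
    case (Suc \<tau>)
    \<comment> \<open>Passing to \<open>Suc \<tau>\<close> shifts the window of summands by one: it
      loses \<open>\<tau> div m\<close> and gains \<open>(\<tau> + m) div m\<close>, which is larger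
      by exactly 1.\<close>
    have "(\<Sum>k<m. (Suc \<tau> + k) div m) + \<tau> div m = (\<Sum>k<Suc m. (\<tau> + k) div m)"
      by (simp only: sum.lessThan_Suc_shift) simp
    also have "\<dots> = \<tau> + Suc (\<tau> div m)"
      using Suc assms by simp
    finally show ?case by simp
  qed
  moreover have "(\<Sum>k = 1..m. slot m k \<tau>) = (\<Sum>k<m. (\<tau> + k) div m)"
    by (rule sum.reindex_bij_witness[of _ Suc "\<lambda>k. k - 1"]) (auto simp: slot_def)
  ultimately show ?thesis by simp
qed

section \<open>Counting and measuring unit slots\<close>

text \<open>Among any \<open>Suc q\<close> elements of \<open>S\<close> the largest would have
  \<open>q\<close> predecessors in \<open>S\<close>. This will bound the starts of a job, as each
  start requires that fewer than all of its loops are done.\<close>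

lemma finite_card_le_of_initial_segments:
  fixes S :: "nat set"
  assumes "\<And>\<tau>. \<tau> \<in> S \<Longrightarrow> card (S \<inter> {..<\<tau>}) < q"
  shows "finite S" "card S \<le> q"
proof -
  have no: False if "T \<subseteq> S" "finite T" "card T = Suc q" for T
  proof -
    have ne: "T \<noteq> {}" using that by auto
    have "T - {Max T} \<subseteq> S \<inter> {..<Max T}"
      using that Max_ge[OF that(2)] by (auto simp: order_less_le)
    then have "card (T - {Max T}) \<le> card (S \<inter> {..<Max T})"
      by (intro card_mono) auto
    moreover have "card (T - {Max T}) = q"
      using that ne by simp
    moreover have "Max T \<in> S"
      using that ne Max_in by blast
    ultimately show False
      using assms[of "Max T"] by simp
  qed
  show "finite S"
    using no infinite_arbitrarily_large[of S "Suc q"] by metis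
  show "card S \<le> q"
    using no obtain_subset_with_card_n[of "Suc q" S] by (metis not_less_eq_eq)
qed

lemma measure_lborel_Ico_max: "measure lborel {a..<b::real} = max 0 (b - a)"
  by (cases "a \<le> b") auto

text \<open>The set is a disjoint union of unit intervals cut off at \<open>s\<close>; the outer
  \<open>max 0\<close> covers those that begin after \<open>s\<close> and are empty.\<close>

lemma measure_slots:
  fixes B :: "nat set"
  assumes "finite B"
  shows "measure lborel {u \<in> {0..<s}. nat \<lfloor>u\<rfloor> \<in> B} = (\<Sum>b\<in>B. max 0 (min (real b + 1) s - real b))"
proof -
  have "{u \<in> {0..<s}. nat \<lfloor>u\<rfloor> \<in> B} = (\<Union>b\<in>B. {real b..<min (real b + 1) s})"
  proof (intro equalityI subsetI)
    fix u assume "u \<in> {u \<in> {0..<s}. nat \<lfloor>u\<rfloor> \<in> B}"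
    then have "nat \<lfloor>u\<rfloor> \<in> B" "0 \<le> u" "u < s" by auto
    moreover have "real (nat \<lfloor>u\<rfloor>) \<le> u" "u < real (nat \<lfloor>u\<rfloor>) + 1"
      using \<open>0 \<le> u\<close> by linarith+
    ultimately show "u \<in> (\<Union>b\<in>B. {real b..<min (real b + 1) s})" by auto
  next
    fix u assume "u \<in> (\<Union>b\<in>B. {real b..<min (real b + 1) s})"
    then obtain b where b: "b \<in> B" "real b \<le> u" "u < real b + 1" "u < s" by auto
    then have "nat \<lfloor>u\<rfloor> = b" by linarith
    with b show "u \<in> {u \<in> {0..<s}. nat \<lfloor>u\<rfloor> \<in> B}" by auto
  qed
  moreover have "measure lborel (\<Union>b\<in>B. {real b..<min (real b + 1) s}) =
      (\<Sum>b\<in>B. measure lborel {real b..<min (real b + 1) s})"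
  proof (rule measure_finite_Union[OF assms])
    show "disjoint_family_on (\<lambda>b. {real b..<min (real b + 1) s}) B"
      by (auto simp: disjoint_family_on_def)
    show "emeasure lborel {real b..<min (real b + 1) s} \<noteq> \<infinity>" for b
      by (cases "real b \<le> min (real b + 1) s") (auto simp del: min.bounded_iff)
  qed auto
  ultimately show ?thesis
    by (simp only: measure_lborel_Ico_max)
qed

text \<open>At most \<open>q\<close> summands, each at most 1, reach \<open>q\<close> only if there
  are \<open>q\<close> of them and all are full; the slot ending last decides. With
  \<open>0 < q\<close>, \<open>B\<close> is nonempty, so \<open>Max B\<close> is meaningful.\<close>

lemma measure_slots_ge_iff:
  fixes B :: "nat set"
  assumes "finite B" "card B \<le> q" "0 < q"
  shows "real q \<le> measure lborel {u \<in> {0..<s}. nat \<lfloor>u\<rfloor> \<in> B} \<longleftrightarrow>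
    card B = q \<and> real (Max B) + 1 \<le> s"
  unfolding measure_slots[OF assms(1)]
proof
  assume *: "real q \<le> (\<Sum>b\<in>B. max 0 (min (real b + 1) s - real b))"
  have le: "(\<Sum>b\<in>B. max 0 (min (real b + 1) s - real b)) \<le> (\<Sum>b\<in>B. 1)"
    by (intro sum_mono) auto
  then have card: "card B = q"
    using * assms by simp
  moreover have "real (Max B) + 1 \<le> s"
  proof (rule ccontr)
    assume "\<not> real (Max B) + 1 \<le> s"
    moreover have "Max B \<in> B"
      using card assms by (intro Max_in) auto
    ultimately have "(\<Sum>b\<in>B. max 0 (min (real b + 1) s - real b)) < (\<Sum>b\<in>B. 1)"
      using assms(1) by (intro sum_strict_mono_ex1) (auto intro!: bexI[of _ "Max B"])
    then show False
      using * card by simp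
  qed
  ultimately show "card B = q \<and> real (Max B) + 1 \<le> s" by simp
next
  assume *: "card B = q \<and> real (Max B) + 1 \<le> s"
  have "max 0 (min (real b + 1) s - real b) = 1" if "b \<in> B" for b
    using * Max_ge[OF assms(1) that] by (auto simp: min_def)
  then show "real q \<le> (\<Sum>b\<in>B. max 0 (min (real b + 1) s - real b))"
    using * by simp
qed

lemma Inf_ereal_real_atLeast: "Inf {ereal (real \<tau>) | \<tau>. c \<le> \<tau>} = ereal (real c)"
  by (rule cInf_eq_minimum) auto

lemma Inf_ereal_atLeast: "Inf {ereal s | s. c \<le> s} = ereal c"
  by (rule cInf_eq_minimum) auto

section \<open>Realizations\<close>

text \<open>Reduces statements about realizations of the auxiliary instance to those of
  \<open>I\<close>. Products commute with \<open>real\<close> here because it maps the default value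
  0 to the default value 0.\<close>

lemma ma_realizations_aux_instance:
  "ma_realizations (aux_instance I k) = (\<lambda>y j. real (y j)) ` fs_realizations I"
proof -
  have "Pi_pmf {1..fs_jobs I} 0 (\<lambda>j. map_pmf real (fs_loops I j)) =
      map_pmf (\<lambda>y. real \<circ> y) (Pi_pmf {1..fs_jobs I} 0 (fs_loops I))"
    by (rule Pi_pmf_map) auto
  then show ?thesis
    by (simp add: ma_realizations_def fs_realizations_def aux_instance_def comp_def)
qed

lemma fs_realizations_pos:
  assumes "flow_shop_instance I" "y \<in> fs_realizations I" "j \<in> {1..fs_jobs I}"
  shows "0 < y j"
proof -
  have "y j \<in> set_pmf (fs_loops I j)"
    using assms(2,3) by (auto simp: fs_realizations_def set_Pi_pmf PiE_dflt_def)
  then show ?thesis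
    using assms(1,3) by (auto simp: flow_shop_instance_def intro!: gr0I)
qed

section \<open>Completion times under a feasible policy\<close>

locale feasible_flow_shop =
  fixes I :: flow_shop and \<pi> :: fs_policy
  assumes inst: "flow_shop_instance I" and feas: "fs_feasible I \<pi>"
begin

abbreviation m :: nat where "m \<equiv> fs_machines I"

abbreviation ma_compl :: "nat \<Rightarrow> (nat \<Rightarrow> nat) \<Rightarrow> nat \<Rightarrow> ereal" where
  "ma_compl k y j \<equiv> ma_completion (aux_instance I k) (induced_policy I k \<pi>) (\<lambda>j. real (y j)) j"

definition starts :: "(nat \<Rightarrow> nat) \<Rightarrow> nat \<Rightarrow> nat set" where
  "starts y j = {\<tau>. \<pi> y \<tau> = Some j}"

lemma m_pos: "0 < m"
  using inst by (simp add: flow_shop_instance_def)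

lemma starts_separated:
  assumes "y \<in> fs_realizations I" "\<tau> \<in> starts y j" "\<tau>' \<in> starts y j" "\<tau> < \<tau>'"
  shows "\<tau> + m \<le> \<tau>'"
  using feas assms unfolding fs_feasible_def starts_def by blast

lemma fs_completed_loops_eq: "fs_completed_loops I \<pi> y j \<tau> = card {\<tau>' \<in> starts y j. \<tau>' + m \<le> \<tau>}"
  by (simp add: fs_completed_loops_def starts_def)

lemma
  assumes y: "y \<in> fs_realizations I"
  shows finite_starts: "finite (starts y j)"
    and card_starts_le: "card (starts y j) \<le> y j"
proof -
  have "card (starts y j \<inter> {..<\<tau>}) < y j" if \<tau>: "\<tau> \<in> starts y j" for \<tau>
  proof -
    have "ereal (real \<tau>) < fs_completion I \<pi> y j"
      using feas y \<tau> by (auto simp: fs_feasible_def starts_def)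
    then have "\<not> y j \<le> fs_completed_loops I \<pi> y j \<tau>"
      unfolding fs_completion_def by (auto simp: not_le[symmetric] intro: Inf_lower)
    \<comment> \<open>When a loop of \<open>j\<close> starts, all earlier loops of \<open>j\<close>
      are complete, so counting completed loops is counting earlier starts.\<close>
    moreover have "{\<tau>' \<in> starts y j. \<tau>' + m \<le> \<tau>} = starts y j \<inter> {..<\<tau>}"
      using starts_separated[OF y _ \<tau>] m_pos by auto
    ultimately show ?thesis
      by (simp add: fs_completed_loops_eq)
  qed
  from finite_card_le_of_initial_segments[OF this]
  show "finite (starts y j)" "card (starts y j) \<le> y j" by auto
qed

text \<open>Positivity of the number of loops excludes the empty set, on which \<open>Max\<close> is
  unspecified.\<close>

lemma Max_starts:
  assumes "y \<in> fs_realizations I" "j \<in> {1..fs_jobs I}" "card (starts y j) = y j"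
  shows "Max (starts y j) \<in> starts y j"
proof -
  have "starts y j \<noteq> {}"
    using fs_realizations_pos[OF inst assms(1,2)] assms(3) by auto
  then show ?thesis
    using finite_starts[OF assms(1)] by simp
qed

lemma fs_completion_eq:
  assumes y: "y \<in> fs_realizations I" and j: "j \<in> {1..fs_jobs I}"
  shows "fs_completion I \<pi> y j =
    (if card (starts y j) = y j then ereal (real (Max (starts y j) + m)) else \<infinity>)"
proof -
  let ?S = "starts y j"
  note fin = finite_starts[OF y, of j] and le = card_starts_le[OF y, of j]
  \<comment> \<open>There are at most \<open>y j\<close> starts, so \<open>y j\<close> completed
    loops must exhaust them, the last one included.\<close>
  have "y j \<le> fs_completed_loops I \<pi> y j \<tau> \<longleftrightarrow> card ?S = y j \<and> Max ?S + m \<le> \<tau>" for \<tau>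
  proof
    assume *: "y j \<le> fs_completed_loops I \<pi> y j \<tau>"
    then have *: "y j \<le> card {\<tau>' \<in> ?S. \<tau>' + m \<le> \<tau>}"
      by (simp add: fs_completed_loops_eq)
    have "{\<tau>' \<in> ?S. \<tau>' + m \<le> \<tau>} = ?S"
      by (rule card_seteq[OF fin]) (use * le in auto)
    moreover from this have "card ?S = y j"
      using * le by simp
    ultimately show "card ?S = y j \<and> Max ?S + m \<le> \<tau>"
      using Max_starts[OF y j] by blast
  next
    assume *: "card ?S = y j \<and> Max ?S + m \<le> \<tau>"
    have "\<tau>' + m \<le> \<tau>" if "\<tau>' \<in> ?S" for \<tau>'
      using * Max_ge[OF fin that] by simp
    then have "{\<tau>' \<in> ?S. \<tau>' + m \<le> \<tau>} = ?S" by auto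
    with * show "y j \<le> fs_completed_loops I \<pi> y j \<tau>"
      by (simp add: fs_completed_loops_eq)
  qed
  then show ?thesis
    by (simp add: fs_completion_def Inf_ereal_real_atLeast top_ereal_def)
qed

section \<open>The induced schedule in terms of slots, and its completion times\<close>

lemma slot_less_starts:
  assumes "y \<in> fs_realizations I" "1 \<le> k" "\<tau> \<in> starts y j" "\<tau>' \<in> starts y j" "\<tau> < \<tau>'"
  shows "slot m k \<tau> < slot m k \<tau>'"
  by (rule slot_less[OF m_pos assms(2) starts_separated[OF assms(1,3,4,5)]])

lemma inj_on_slot_starts:
  assumes "y \<in> fs_realizations I" "1 \<le> k"
  shows "inj_on (slot m k) (starts y j)"
  by (rule linorder_inj_onI) (use slot_less_starts[OF assms] in \<open>fastforce+\<close>)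

text \<open>Inverts the definition: instead of looking up \<open>\<pi>\<close> from machine and
  time, it asks which start is served there, and the arrival time disappears into
  \<open>slot\<close>. The conjunct \<open>0 \<le> s\<close> is needed because \<open>nat\<close>
  sends negative floors to slot 0.\<close>

lemma induced_policy_eq_Some_iff:
  assumes k: "k \<in> {1..m}"
  shows "induced_policy I k \<pi> (\<lambda>j. real (y j)) i s = Some j \<longleftrightarrow>
    0 \<le> s \<and> (\<exists>\<tau>\<in>starts y j. \<tau> mod m + 1 = i \<and> slot m k \<tau> = nat \<lfloor>s\<rfloor>)"
proof -
  define a :: nat where "a = (if i + k \<le> m + 1 then 0 else 1)"
  have a: "ma_arrival (aux_instance I k) i = real a"
    by (simp add: a_def aux_instance_def)
  \<comment> \<open>Valid also for \<open>s\<close> below \<open>a\<close>, where both sides are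
    truncated to 0.\<close>
  have nat_floor: "nat \<lfloor>s - real a\<rfloor> = nat \<lfloor>s\<rfloor> - a" for s
    by linarith
  have "induced_policy I k \<pi> (\<lambda>j. real (y j)) i s =
    (if i \<in> {1..m} \<and> real a \<le> s then \<pi> y (m * (nat \<lfloor>s\<rfloor> - a) + i - 1) else None)"
    by (simp add: induced_policy_def Let_def a nat_floor)
  then have "induced_policy I k \<pi> (\<lambda>j. real (y j)) i s = Some j \<longleftrightarrow>
    i \<in> {1..m} \<and> real a \<le> s \<and> \<pi> y (m * (nat \<lfloor>s\<rfloor> - a) + i - 1) = Some j" (is "_ \<longleftrightarrow> ?L")
    by (simp only: split: if_split) blast
  also have "\<dots> \<longleftrightarrow> 0 \<le> s \<and> (\<exists>\<tau>\<in>starts y j. \<tau> mod m + 1 = i \<and> slot m k \<tau> = nat \<lfloor>s\<rfloor>)" (is "_ \<longleftrightarrow> ?R")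
  proof
    assume L: ?L
    let ?\<tau> = "m * (nat \<lfloor>s\<rfloor> - a) + i - 1"
    have i: "1 \<le> i" "i \<le> m" using L by auto
    have "?\<tau> = m * (nat \<lfloor>s\<rfloor> - a) + (i - 1)" using i by simp
    then have "?\<tau> mod m = (i - 1) mod m" by simp
    then have "?\<tau> mod m + 1 = i" using i by simp
    moreover have "slot m k ?\<tau> = nat \<lfloor>s\<rfloor> - a + a"
      unfolding a_def by (rule slot_eq) (use i k in auto)
    moreover have "a \<le> nat \<lfloor>s\<rfloor>" using L by linarith
    moreover have "0 \<le> s" using L by linarith
    ultimately show ?R using L by (auto simp: starts_def intro!: bexI[of _ ?\<tau>])
  next
    assume ?R
    then obtain \<tau> where \<tau>: "0 \<le> s" "\<tau> \<in> starts y j" "\<tau> mod m + 1 = i" "slot m k \<tau> = nat \<lfloor>s\<rfloor>"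
      by blast
    have i: "1 \<le> i" "i \<le> m"
      using \<tau>(3) mod_less_divisor[OF m_pos, of \<tau>] by linarith+
    have t: "m * (\<tau> div m) + i - 1 = \<tau>"
      using \<tau>(3) by (metis add_diff_cancel_right' add.assoc mult_div_mod_eq)
    have "slot m k (m * (\<tau> div m) + i - 1) = \<tau> div m + a"
      unfolding a_def by (rule slot_eq) (use i k in auto)
    then have "nat \<lfloor>s\<rfloor> = \<tau> div m + a"
      using t \<tau>(4) by simp
    moreover from this have "real a \<le> s"
      using \<tau>(1) by linarith
    ultimately show ?L
      using t \<tau>(2) i by (simp add: starts_def)
  qed
  finally show ?thesis .
qed

text \<open>Injectivity of \<open>slot\<close> on the starts of \<open>j\<close> makes the times
  spent on different machines disjoint, so the sum of measures is the measure of the union.\<close>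

lemma ma_received_eq:
  assumes y: "y \<in> fs_realizations I" and k: "k \<in> {1..m}"
  shows "ma_received (aux_instance I k) (induced_policy I k \<pi>) (\<lambda>j. real (y j)) j s =
    measure lborel {u \<in> {0..<s}. nat \<lfloor>u\<rfloor> \<in> slot m k ` starts y j}"
proof -
  define A where "A i = {u \<in> {0..<s}. induced_policy I k \<pi> (\<lambda>j. real (y j)) i u = Some j}" for i
  have A: "A i = {u \<in> {0..<s}. nat \<lfloor>u\<rfloor> \<in> slot m k ` {\<tau> \<in> starts y j. \<tau> mod m + 1 = i}}" for i
    unfolding A_def induced_policy_eq_Some_iff[OF k] by (auto simp: image_iff)
  have "measure lborel (\<Union>i\<in>{1..m}. A i) = (\<Sum>i\<in>{1..m}. measure lborel (A i))"
  proof (rule measure_finite_Union)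
    show "disjoint_family_on A {1..m}"
      unfolding disjoint_family_on_def
    proof (intro ballI impI, rule ccontr)
      fix i i' assume "i \<noteq> i'" "A i \<inter> A i' \<noteq> {}"
      then obtain u where "u \<in> A i" "u \<in> A i'" by blast
      then obtain \<tau> \<tau>' where \<tau>: "\<tau> \<in> starts y j" "\<tau>' \<in> starts y j" "\<tau> mod m + 1 = i" "\<tau>' mod m + 1 = i'"
          and eq: "nat \<lfloor>u\<rfloor> = slot m k \<tau>" "nat \<lfloor>u\<rfloor> = slot m k \<tau>'"
        unfolding A by blast
      have "\<tau> = \<tau>'"
        using inj_onD[OF inj_on_slot_starts[OF y] trans[OF eq(1)[symmetric] eq(2)] \<tau>(1,2)] k by simp
      with \<tau> \<open>i \<noteq> i'\<close> show False by simp
    qed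
    show "A ` {1..m} \<subseteq> sets lborel"
      unfolding A by auto
    show "emeasure lborel (A i) \<noteq> \<infinity>" for i
    proof -
      have "emeasure lborel (A i) \<le> emeasure lborel {0..s}"
        unfolding A by (intro emeasure_mono) auto
      then show ?thesis
        by (metis emeasure_lborel_cbox_finite infinity_ennreal_def interval_cbox leD)
    qed
  qed simp
  moreover have "(\<Union>i\<in>{1..m}. A i) = {u \<in> {0..<s}. nat \<lfloor>u\<rfloor> \<in> slot m k ` starts y j}"
  proof (intro equalityI subsetI)
    fix u assume "u \<in> {u \<in> {0..<s}. nat \<lfloor>u\<rfloor> \<in> slot m k ` starts y j}"
    then obtain \<tau> where "\<tau> \<in> starts y j" "nat \<lfloor>u\<rfloor> = slot m k \<tau>" "u \<in> {0..<s}" by blast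
    then have "u \<in> A (\<tau> mod m + 1)"
      unfolding A by blast
    moreover have "\<tau> mod m + 1 \<in> {1..m}"
      using m_pos by (simp add: Suc_le_eq)
    ultimately show "u \<in> (\<Union>i\<in>{1..m}. A i)" by blast
  qed (unfold A, blast)
  moreover have "ma_machines (aux_instance I k) = m"
    by (simp add: aux_instance_def)
  ultimately show ?thesis
    by (simp add: ma_received_def A_def)
qed

lemma ma_completion_eq:
  assumes y: "y \<in> fs_realizations I" and j: "j \<in> {1..fs_jobs I}" and k: "k \<in> {1..m}"
  shows "ma_compl k y j =
    (if card (starts y j) = y j then ereal (real (slot m k (Max (starts y j))) + 1) else \<infinity>)"
proof -
  let ?S = "starts y j"
  note fin = finite_starts[OF y, of j]
  have pos: "0 < y j"
    by (rule fs_realizations_pos[OF inst y j])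
  have card: "card (slot m k ` ?S) = card ?S"
    using k by (intro card_image inj_on_slot_starts y) auto
  \<comment> \<open>By monotonicity the last start occupies the last slot, whose right end is the
    completion time.\<close>
  have Max: "Max (slot m k ` ?S) = slot m k (Max ?S)" if "card ?S = y j"
    using that pos fin by (subst mono_Max_commute[symmetric]) (auto intro: monoI slot_mono)
  have "0 \<le> s \<and> real (y j) \<le> ma_received (aux_instance I k) (induced_policy I k \<pi>) (\<lambda>j. real (y j)) j s
      \<longleftrightarrow> card ?S = y j \<and> real (slot m k (Max ?S)) + 1 \<le> s" for s
    unfolding ma_received_eq[OF y k]
    using measure_slots_ge_iff[of "slot m k ` ?S" "y j" s] fin card card_starts_le[OF y, of j] pos Max
    by auto
  then show ?thesis
    by (simp add: ma_completion_def Inf_ereal_atLeast top_ereal_def)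
qed

lemma fs_completion_eq_sum:
  assumes y: "y \<in> fs_realizations I" and j: "j \<in> {1..fs_jobs I}"
  shows "fs_completion I \<pi> y j = (\<Sum>k = 1..m. ma_compl k y j)"
proof (cases "card (starts y j) = y j")
  case True
  have "(\<Sum>k = 1..m. ma_compl k y j) = (\<Sum>k = 1..m. ereal (real (slot m k (Max (starts y j))) + 1))"
    using ma_completion_eq[OF y j] True by (intro sum.cong) auto
  also have "\<dots> = ereal (real (\<Sum>k = 1..m. slot m k (Max (starts y j))) + real m)"
    by (simp add: sum.distrib)
  also have "\<dots> = fs_completion I \<pi> y j"
    unfolding sum_slot[OF m_pos] using True by (simp add: fs_completion_eq[OF y j])
  finally show ?thesis ..
next
  case False
  then have "(\<Sum>k = 1..m. ma_compl k y j) = (\<Sum>k = 1..m. \<infinity>)"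
    using ma_completion_eq[OF y j] by (intro sum.cong) auto
  \<comment> \<open>At least one machine exists, so the sum is not empty.\<close>
  also have "\<dots> = \<infinity>"
    using m_pos by (subst sum_Pinfty) auto
  finally show ?thesis
    using False by (simp add: fs_completion_eq[OF y j])
qed

section \<open>Feasibility of the induced policies\<close>

text \<open>Completion by \<open>\<tau>\<close> under \<open>y\<close> puts the completion in the
  auxiliary instance at or before \<open>s\<close>, so \<open>same\<close> equates the slots of the
  two last starts. The hypotheses on completion are one-sided so that the lemma can be applied again
  with \<open>y\<close> and \<open>y'\<close> exchanged.\<close>

lemma fs_completion_transfer:
  assumes y: "y \<in> fs_realizations I" and y': "y' \<in> fs_realizations I"
    and j: "j \<in> {1..fs_jobs I}" and k: "k \<in> {1..m}"
    and agree: "\<And>\<tau>'. \<tau>' < \<tau> \<Longrightarrow> \<pi> y \<tau>' = \<pi> y' \<tau>'"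
    and slot: "real (slot m k \<tau>) \<le> s"
    and same: "ma_compl k y j \<le> ereal s \<Longrightarrow> ma_compl k y j = ma_compl k y' j"
    and le: "fs_completion I \<pi> y j \<le> ereal (real \<tau>)"
  shows "fs_completion I \<pi> y j = fs_completion I \<pi> y' j"
proof -
  let ?l = "Max (starts y j)" and ?l' = "Max (starts y' j)"
  have card: "card (starts y j) = y j"
    using le by (simp add: fs_completion_eq[OF y j] split: if_splits)
  then have l: "?l + m \<le> \<tau>"
    using le by (simp add: fs_completion_eq[OF y j])
  then have less: "slot m k ?l < slot m k \<tau>"
    using k by (intro slot_less m_pos) auto
  then have "ma_compl k y j \<le> ereal s"
    using card slot by (simp add: ma_completion_eq[OF y j k])
  then have "ma_compl k y' j = ereal (real (slot m k ?l) + 1)"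
    using same card by (simp add: ma_completion_eq[OF y j k])
  then have card': "card (starts y' j) = y' j" and eq: "slot m k ?l' = slot m k ?l"
    by (auto simp: ma_completion_eq[OF y' j k] split: if_splits)
  have "?l' < \<tau>"
    using less eq slot_mono[of \<tau> ?l' m k] by (auto simp: not_less[symmetric])
  \<comment> \<open>The last start under \<open>y'\<close> precedes \<open>\<tau>\<close>, where the
    decisions agree; being a start under \<open>y\<close> in the slot of \<open>?l\<close>, it must
    be \<open>?l\<close>.\<close>
  then have "?l' \<in> starts y j"
    using Max_starts[OF y' j card'] agree by (simp add: starts_def)
  then have "?l' = ?l"
    using inj_onD[OF inj_on_slot_starts[OF y] eq] Max_starts[OF y j card] k by auto
  then show ?thesis
    using card card' by (simp add: fs_completion_eq[OF y j] fs_completion_eq[OF y' j])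
qed

text \<open>\<open>ma_same_past\<close> compares completions only, so agreement of the earlier
  decisions is rebuilt by strong induction; the slot bound passes to earlier times by
  monotonicity.\<close>

lemma nonanticipative_slots:
  assumes y: "y \<in> fs_realizations I" and y': "y' \<in> fs_realizations I" and k: "k \<in> {1..m}"
    and same: "ma_same_past (aux_instance I k) (induced_policy I k \<pi>) s
      (\<lambda>j. real (y j)) (\<lambda>j. real (y' j))"
    and slot: "real (slot m k \<tau>) \<le> s"
  shows "\<pi> y \<tau> = \<pi> y' \<tau>"
  using slot
proof (induction \<tau> rule: less_induct)
  case (less \<tau>)
  have agree: "\<pi> y \<tau>' = \<pi> y' \<tau>'" if "\<tau>' < \<tau>" for \<tau>'
  proof (rule less.IH[OF that])
    have "slot m k \<tau>' \<le> slot m k \<tau>" using that by (intro slot_mono) simp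
    then show "real (slot m k \<tau>') \<le> s" using less.prems by linarith
  qed
  have jobs: "ma_jobs (aux_instance I k) = fs_jobs I"
    by (simp add: aux_instance_def)
  have "fs_same_past I \<pi> \<tau> y y'"
    unfolding fs_same_past_def
  proof (intro conjI allI impI ballI)
    fix j assume j: "j \<in> {1..fs_jobs I}"
      and "fs_completion I \<pi> y j \<le> ereal (real \<tau>) \<or> fs_completion I \<pi> y' j \<le> ereal (real \<tau>)"
    then consider "fs_completion I \<pi> y j \<le> ereal (real \<tau>)" | "fs_completion I \<pi> y' j \<le> ereal (real \<tau>)"
      by blast
    moreover have compl: "ma_compl k y j = ma_compl k y' j"
      if "ma_compl k y j \<le> ereal s \<or> ma_compl k y' j \<le> ereal s"
      using same j that unfolding ma_same_past_def jobs by blast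
    ultimately show "fs_completion I \<pi> y j = fs_completion I \<pi> y' j"
    proof cases
      case 1
      then show ?thesis
        using fs_completion_transfer[OF y y' j k agree less.prems] compl by blast
    next
      case 2
      then show ?thesis
        using fs_completion_transfer[OF y' y j k agree[symmetric] less.prems] compl by metis
    qed
  qed (rule agree)
  then show ?case
    using feas y y' by (auto simp: fs_feasible_def)
qed

lemma ma_feasible_induced_policy:
  assumes k: "k \<in> {1..m}"
  shows "ma_feasible (aux_instance I k) (induced_policy I k \<pi>)"
proof -
  let ?\<sigma> = "\<lambda>y. induced_policy I k \<pi> (\<lambda>j. real (y j))"
  have meas: "{s. ?\<sigma> y i s = Some j} \<in> sets borel" for y i j
  proof -
    \<comment> \<open>A countable union of half-open intervals, hence Borel for every
      \<open>y\<close>, realization or not.\<close>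
    have "{s. ?\<sigma> y i s = Some j} =
      (\<Union>\<tau>\<in>{\<tau> \<in> starts y j. \<tau> mod m + 1 = i}. {real (slot m k \<tau>)..<real (slot m k \<tau>) + 1})"
      unfolding induced_policy_eq_Some_iff[OF k]
    proof (intro equalityI subsetI)
      fix s :: real assume "s \<in> {s. 0 \<le> s \<and> (\<exists>\<tau>\<in>starts y j. \<tau> mod m + 1 = i \<and> slot m k \<tau> = nat \<lfloor>s\<rfloor>)}"
      then obtain \<tau> where \<tau>: "0 \<le> s" "\<tau> \<in> starts y j" "\<tau> mod m + 1 = i" "slot m k \<tau> = nat \<lfloor>s\<rfloor>"
        by blast
      then have "s \<in> {real (slot m k \<tau>)..<real (slot m k \<tau>) + 1}"
        by simp
      with \<tau> show "s \<in> (\<Union>\<tau>\<in>{\<tau> \<in> starts y j. \<tau> mod m + 1 = i}.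
          {real (slot m k \<tau>)..<real (slot m k \<tau>) + 1})"
        by blast
    next
      fix s :: real assume "s \<in> (\<Union>\<tau>\<in>{\<tau> \<in> starts y j. \<tau> mod m + 1 = i}.
          {real (slot m k \<tau>)..<real (slot m k \<tau>) + 1})"
      then obtain \<tau> where \<tau>: "\<tau> \<in> starts y j" "\<tau> mod m + 1 = i"
          "real (slot m k \<tau>) \<le> s" "s < real (slot m k \<tau>) + 1"
        by auto
      then have "0 \<le> s" "slot m k \<tau> = nat \<lfloor>s\<rfloor>"
        by linarith+
      with \<tau> show "s \<in> {s. 0 \<le> s \<and> (\<exists>\<tau>\<in>starts y j. \<tau> mod m + 1 = i \<and> slot m k \<tau> = nat \<lfloor>s\<rfloor>)}"
        by blast
    qed
    also have "\<dots> \<in> sets borel"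
      by (intro sets.countable_UN') auto
    finally show ?thesis .
  qed
  have step: "i \<in> {1..ma_machines (aux_instance I k)} \<and> j \<in> {1..ma_jobs (aux_instance I k)} \<and>
      ma_arrival (aux_instance I k) i \<le> s \<and> ereal s < ma_compl k y j \<and>
      (\<forall>i'. ?\<sigma> y i' s = Some j \<longrightarrow> i' = i)"
    if y: "y \<in> fs_realizations I" and \<sigma>: "?\<sigma> y i s = Some j" for y i s j
  proof -
    obtain \<tau> where \<tau>: "0 \<le> s" "\<tau> \<in> starts y j" "\<tau> mod m + 1 = i" "slot m k \<tau> = nat \<lfloor>s\<rfloor>"
      using \<sigma> unfolding induced_policy_eq_Some_iff[OF k] by blast
    have i: "i \<in> {1..m}" "ma_arrival (aux_instance I k) i \<le> s"
      using \<sigma> by (auto simp: induced_policy_def Let_def split: if_splits)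
    have j: "j \<in> {1..fs_jobs I}"
      using feas y \<tau>(2) by (auto simp: fs_feasible_def starts_def)
    have "slot m k \<tau> \<le> slot m k (Max (starts y j))"
      using \<tau>(2) finite_starts[OF y] by (intro slot_mono) simp
    then have "s < real (slot m k (Max (starts y j))) + 1"
      using \<tau>(1,4) by linarith
    \<comment> \<open>If the job is never finished, its completion time is infinite and the bound is
      immediate.\<close>
    then have "ereal s < ma_compl k y j"
      by (simp add: ma_completion_eq[OF y j k])
    moreover have "i' = i" if "?\<sigma> y i' s = Some j" for i'
    proof -
      obtain \<tau>' where \<tau>': "\<tau>' \<in> starts y j" "\<tau>' mod m + 1 = i'" "slot m k \<tau>' = nat \<lfloor>s\<rfloor>"
        using \<open>?\<sigma> y i' s = Some j\<close> unfolding induced_policy_eq_Some_iff[OF k] by blast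
      then have "\<tau>' = \<tau>"
        using inj_onD[OF inj_on_slot_starts[OF y, of k j], of \<tau>' \<tau>] \<tau> k by auto
      with \<tau> \<tau>' show ?thesis by simp
    qed
    ultimately show ?thesis
      using i j by (simp add: aux_instance_def)
  qed
  have nonant: "?\<sigma> y i s = ?\<sigma> y' i s"
    if y: "y \<in> fs_realizations I" and y': "y' \<in> fs_realizations I"
      and same: "ma_same_past (aux_instance I k) (induced_policy I k \<pi>) s
        (\<lambda>j. real (y j)) (\<lambda>j. real (y' j))" for y y' i s
  proof -
    have "?\<sigma> y i s = Some j \<longleftrightarrow> ?\<sigma> y' i s = Some j" for j
    proof -
      \<comment> \<open>What runs at time \<open>s\<close> depends only on decisions whose slot
        contains \<open>s\<close>; such a slot begins no later than \<open>s\<close>.\<close>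
      have "\<tau> \<in> starts y j \<longleftrightarrow> \<tau> \<in> starts y' j" if "0 \<le> s" "slot m k \<tau> = nat \<lfloor>s\<rfloor>" for \<tau>
      proof -
        have "real (slot m k \<tau>) \<le> s" using that by linarith
        from nonanticipative_slots[OF y y' k same this] show ?thesis
          by (simp add: starts_def)
      qed
      then show ?thesis
        unfolding induced_policy_eq_Some_iff[OF k] by blast
    qed
    then show ?thesis
      by (rule option_eqI)
  qed
  show ?thesis
    unfolding ma_feasible_def ma_realizations_aux_instance
    apply (intro conjI)
      apply (intro ballI allI, elim imageE, hypsubst, rule meas)
     apply (intro ballI allI impI, elim imageE, hypsubst, rule step, assumption+)
    apply (intro ballI allI impI, elim imageE, hypsubst, rule nonant, assumption+)
    done
qed

end

theorem theorem2:
  fixes I :: flow_shop and \<pi> :: fs_policy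
  assumes "flow_shop_instance I"
    and "fs_feasible I \<pi>"
  shows "(\<forall>k\<in>{1..fs_machines I}. ma_feasible (aux_instance I k) (induced_policy I k \<pi>)) \<and>
    (\<forall>j\<in>{1..fs_jobs I}. \<forall>y\<in>fs_realizations I.
       fs_completion I \<pi> y j =
         (\<Sum>k=1..fs_machines I.
            ma_completion (aux_instance I k) (induced_policy I k \<pi>) (\<lambda>j. real (y j)) j))"
proof -
  interpret feasible_flow_shop I \<pi>
    using assms by unfold_locales
  show ?thesis
    using ma_feasible_induced_policy fs_completion_eq_sum by blast
qed

end
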